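(* Let $d\ge 2$ be an integer, let $\varepsilon>0$, and put $n=\lceil 1/\varepsilon\rceil$. Suppose it is known in advance that the (otherwise unknown) collection of preference sets $\{A_{ij}\}_{i,j\in\{1,\ldots,d\}}$ on the simplex $A$ has the following property: each $A_{ij}$ is a proper subset of $A$, is the intersection of $A$ and a closed half-space with boundary hyperplane parallel to the facet $F_j$, and satisfies $F_j\subset A_{ij}$. Then an $\varepsilon$-fair division point can be found in binary mode using at most $$(d-1)^2\left\lceil \log_2\big(n\cdot(d-1)\big)\right\rceil$$ queries. That is, there is an adaptive algorithm in binary mode which, for every collection with this property, makes at most this many queries and outputs an $\varepsilon$-fair division point.
   Context: Let $A$ be a $(d-1)$-dimensional regular simplex with edges of Euclidean length $1$ in $\mathbb{R}^{d-1}$, with vertices $v_1,\ldots,v_d$. Each $x\in A$ is written in barycentric coordinates as $x=[\alpha_1,\ldots,\alpha_d]=\sum_i\alpha_i v_i$ with $\alpha_i\ge 0$, $\sum_i\alpha_i=1$. The facet $F_j$ is the convex hull of $\{v_k\}_{k\ne j}$, so hyperplanes parallel to $F_j$ are those of the form $\{\alpha_j=\text{const}\}$. The metric is $\operatorname{dist}([\alpha_1,\ldots,\alpha_d],[\alpha'_1,\ldots,\alpha'_d])=\max_i|\alpha_i-\alpha'_i|$ (extended to $\mathbb{R}^{d-1}$ by the same formula in affine barycentric coordinates). Preference sets: a collection $\{A_{ij}\}_{i,j\in\{1,\ldots,d\}}$ of closed subsets of $A$ such that for each $i$ (an agent) $\bigcup_{j=1}^d A_{ij}=A$. For $\varepsilon\ge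 0$ put $A^{\varepsilon}_{ij}=\{x\in\mathbb{R}^{d-1}:\operatorname{dist}(x,A_{ij})\le\varepsilon\}$. A point $x\in A$ is an $\varepsilon$-fair division point if there is a permutation $\sigma$ of $\{1,\ldots,d\}$ with $x\in A^{\varepsilon}_{i\sigma(i)}$ for all $i$. Query model: the sets $A_{ij}$ are fixed but unknown to the algorithm. A query in binary mode consists of choosing indices $i,j\in\{1,\ldots,d\}$ and a point $x\in A$; the answer is "yes" if $x\in A_{ij}$ and "no" otherwise. Each query may depend on the previous answers, and after its queries the algorithm outputs a point of $A$ depending only on $d$, $\varepsilon$ and the answers received. Only the number of queries is counted. *)

theory Defs
  imports "HOL-Analysis.Analysis"
begin

text \<open>
  The simplex lives in a Euclidean space \<open>'a\<close> of dimension \<open>d - 1\<close>; its vertices are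
  \<open>v 1, \<dots>, v d\<close>, and the values of \<open>v\<close> at other indices are irrelevant.
\<close>

definition regular_unit_simplex_vertices :: "nat \<Rightarrow> (nat \<Rightarrow> 'a::euclidean_space) \<Rightarrow> bool" where
  "regular_unit_simplex_vertices d v \<longleftrightarrow>
     (\<forall>i\<in>{1..d}. \<forall>j\<in>{1..d}. i \<noteq> j \<longrightarrow> dist (v i) (v j) = 1)"

definition vertex_simplex :: "nat \<Rightarrow> (nat \<Rightarrow> 'a::euclidean_space) \<Rightarrow> 'a set" where
  "vertex_simplex d v = convex hull (v ` {1..d})"

definition facet :: "nat \<Rightarrow> (nat \<Rightarrow> 'a::euclidean_space) \<Rightarrow> nat \<Rightarrow> 'a set" where
  "facet d v j = convex hull (v ` ({1..d} - {j}))"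

text \<open>
  Affine barycentric coordinates, defined on the whole space (coordinates may be negative).
  They exist and are unique when \<open>v 1, \<dots>, v d\<close> are affinely independent and
  \<open>DIM('a) = d - 1\<close>. The value \<open>0\<close> outside \<open>{1..d}\<close> makes the coordinate function unique.
\<close>

definition barycentric :: "nat \<Rightarrow> (nat \<Rightarrow> 'a::euclidean_space) \<Rightarrow> 'a \<Rightarrow> nat \<Rightarrow> real" where
  "barycentric d v x =
     (THE \<alpha>. (\<forall>i. i \<notin> {1..d} \<longrightarrow> \<alpha> i = 0) \<and> (\<Sum>i=1..d. \<alpha> i) = 1 \<and> x = (\<Sum>i=1..d. \<alpha> i *\<^sub>R v i))"

definition bary_dist :: "nat \<Rightarrow> (nat \<Rightarrow> 'a::euclidean_space) \<Rightarrow> 'a \<Rightarrow> 'a \<Rightarrow> real" where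
  "bary_dist d v x y = Max ((\<lambda>i. \<bar>barycentric d v x i - barycentric d v y i\<bar>) ` {1..d})"

text \<open>
  The distance from a point to the empty set is infinite, so the neighbourhood of the empty set
  is empty; the explicit conjunct is needed because \<open>Inf {}\<close> is a junk value on the reals.
\<close>

definition enlargement ::
    "nat \<Rightarrow> (nat \<Rightarrow> 'a::euclidean_space) \<Rightarrow> real \<Rightarrow> 'a set \<Rightarrow> 'a set" where
  "enlargement d v \<epsilon> S = {x. S \<noteq> {} \<and> (INF y\<in>S. bary_dist d v x y) \<le> \<epsilon>}"

definition preference_sets ::
    "nat \<Rightarrow> (nat \<Rightarrow> 'a::euclidean_space) \<Rightarrow> (nat \<Rightarrow> nat \<Rightarrow> 'a set) \<Rightarrow> bool" where
  "preference_sets d v P \<longleftrightarrow>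
     (\<forall>i\<in>{1..d}. \<forall>j\<in>{1..d}. closed (P i j) \<and> P i j \<subseteq> vertex_simplex d v) \<and>
     (\<forall>i\<in>{1..d}. (\<Union>j\<in>{1..d}. P i j) = vertex_simplex d v)"

definition fair_division_point ::
    "nat \<Rightarrow> (nat \<Rightarrow> 'a::euclidean_space) \<Rightarrow> real \<Rightarrow> (nat \<Rightarrow> nat \<Rightarrow> 'a set) \<Rightarrow> 'a \<Rightarrow> bool" where
  "fair_division_point d v \<epsilon> P x \<longleftrightarrow>
     x \<in> vertex_simplex d v \<and>
     (\<exists>\<sigma>. \<sigma> permutes {1..d} \<and> (\<forall>i\<in>{1..d}. x \<in> enlargement d v \<epsilon> (P i (\<sigma> i))))"

definition parallel_halfspace_sets ::
    "nat \<Rightarrow> (nat \<Rightarrow> 'a::euclidean_space) \<Rightarrow> (nat \<Rightarrow> nat \<Rightarrow> 'a set) \<Rightarrow> bool" where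
  "parallel_halfspace_sets d v P \<longleftrightarrow>
     (\<forall>i\<in>{1..d}. \<forall>j\<in>{1..d}.
        P i j \<subset> vertex_simplex d v \<and>
        (\<exists>a b. a \<noteq> 0 \<and> affine_parallel {x. a \<bullet> x = b} (affine hull (facet d v j)) \<and>
           P i j = vertex_simplex d v \<inter> {x. a \<bullet> x \<le> b}) \<and>
        facet d v j \<subseteq> P i j)"

text \<open>
  A deterministic adaptive algorithm in binary mode is a binary decision tree:
  \<open>Query i j x T U\<close> asks whether \<open>x \<in> A\<^sub>i\<^sub>j\<close>, continuing with \<open>T\<close> after the answer
  ``yes'' and with \<open>U\<close> after ``no''.
\<close>

datatype 'a binary_algorithm =
    Output 'a
  | Query nat nat 'a "'a binary_algorithm" "'a binary_algorithm"

primrec admissible ::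
    "nat \<Rightarrow> (nat \<Rightarrow> 'a::euclidean_space) \<Rightarrow> 'a binary_algorithm \<Rightarrow> bool" where
  "admissible d v (Output x) \<longleftrightarrow> x \<in> vertex_simplex d v"
| "admissible d v (Query i j x T U) \<longleftrightarrow>
     i \<in> {1..d} \<and> j \<in> {1..d} \<and> x \<in> vertex_simplex d v \<and> admissible d v T \<and> admissible d v U"

primrec result :: "(nat \<Rightarrow> nat \<Rightarrow> 'a set) \<Rightarrow> 'a binary_algorithm \<Rightarrow> 'a" where
  "result P (Output x) = x"
| "result P (Query i j x T U) = (if x \<in> P i j then result P T else result P U)"

primrec query_count :: "(nat \<Rightarrow> nat \<Rightarrow> 'a set) \<Rightarrow> 'a binary_algorithm \<Rightarrow> nat" where
  "query_count P (Output x) = 0"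
| "query_count P (Query i j x T U) =
     Suc (if x \<in> P i j then query_count P T else query_count P U)"

end

theory Submission
  imports Defs
begin

text \<open>
  In barycentric coordinates \<open>P i j = {\<alpha>. \<alpha> j \<le> t i j}\<close> with \<open>0 \<le> t i j < 1\<close>, and covering the simplex
  means \<open>(\<Sum>j. t i j) \<ge> 1\<close>. Bisection along an edge finds \<open>t i j\<close> within \<open>1 / (n (d - 1))\<close> for
  \<open>i, j < d\<close>; by covering, \<open>t i d\<close> is then bounded below with error at most \<open>\<epsilon>\<close>. Agent \<open>d\<close> is never
  asked: given lower bounds \<open>b i j\<close> with row sums at least 1, a point of the simplex minimizing
  \<open>\<Sum>i<d. max\<^sub>k (b i k - \<alpha> k)\<close> has the property that any nonempty set \<open>S\<close> of agents other than \<open>d\<close>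
  accepts more than \<open>card S\<close> pieces. By Hall's theorem, whatever piece agent \<open>d\<close> takes, the remaining
  pieces can be distributed among the others.
\<close>

section \<open>Hall's theorem and expanding points of the simplex\<close>

text \<open>Strong induction on \<open>card I\<close>. If some nonempty proper subset
  \<open>S\<close> is tight, \<open>S\<close> is matched into its neighbourhood \<open>U\<close> and
  \<open>I - S\<close> outside \<open>U\<close>. If there is none, every nonempty proper subset has
  a neighbour to spare, so one index can be matched arbitrarily and its partner deleted.\<close>

lemma hall_marriage:
  assumes "finite I" and "\<And>i. i \<in> I \<Longrightarrow> finite (A i)"
    and "\<And>S. S \<subseteq> I \<Longrightarrow> card S \<le> card (\<Union>i\<in>S. A i)"
  shows "\<exists>R. inj_on R I \<and> (\<forall>i\<in>I. R i \<in> A i)"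
  using assms
proof (induction "card I" arbitrary: I A rule: less_induct)
  case less
  note finI = less.prems(1) and finA = less.prems(2) and hall = less.prems(3)
  show ?case
  proof (cases "I = {}")
    case False
    show ?thesis
    proof (cases "\<exists>S. S \<subset> I \<and> S \<noteq> {} \<and> card (\<Union>i\<in>S. A i) \<le> card S")
      case True
      then obtain S where S: "S \<subset> I" "S \<noteq> {}" and tight: "card (\<Union>i\<in>S. A i) \<le> card S"
        by blast
      define U where "U = (\<Union>i\<in>S. A i)"
      have finS: "finite S" using S finI finite_subset by blast
      have finU: "finite U" unfolding U_def using S finA finS by blast
      have "card S < card I" using S finI psubset_card_mono by blast
      then obtain R1 where R1: "inj_on R1 S" "\<forall>i\<in>S. R1 i \<in> A i"
        using less.hyps[of S A] finS finA hall S by (metis psubset_imp_subset subset_iff subset_trans)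
      have "card (I - S) < card I" using S finI by (intro psubset_card_mono) auto
      \<comment> \<open>Hall's condition for \<open>S \<union> T\<close>, minus the tightness of
        \<open>S\<close>.\<close>
      moreover have "card T \<le> card (\<Union>i\<in>T. A i - U)" if T: "T \<subseteq> I - S" for T
      proof -
        have finT: "finite T" using T finI finite_subset by blast
        have finT': "finite (\<Union>i\<in>T. A i - U)" using T finT finA by blast
        have "card S + card T = card (S \<union> T)"
          using T finS finT by (subst card_Un_disjoint) auto
        also have "\<dots> \<le> card (\<Union>i\<in>S \<union> T. A i)" using hall S T by (meson Diff_subset Un_least psubsetE subset_trans)
        also have "(\<Union>i\<in>S \<union> T. A i) = U \<union> (\<Union>i\<in>T. A i - U)" unfolding U_def by auto
        also have "card \<dots> = card U + card (\<Union>i\<in>T. A i - U)"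
          using finU finT' by (subst card_Un_disjoint) auto
        finally show ?thesis using tight unfolding U_def by simp
      qed
      ultimately obtain R2 where R2: "inj_on R2 (I - S)" "\<forall>i\<in>I - S. R2 i \<in> A i - U"
        using less.hyps[of "I - S" "\<lambda>i. A i - U"] finI finA by (metis Diff_iff finite_Diff)
      let ?R = "\<lambda>i. if i \<in> S then R1 i else R2 i"
      have R1U: "\<And>i. i \<in> S \<Longrightarrow> R1 i \<in> U" using R1 unfolding U_def by blast
      have "inj_on ?R I"
      proof -
        have "R1 ` S \<inter> R2 ` (I - S) = {}" 
        proof (rule ccontr)
          assume "R1 ` S \<inter> R2 ` (I - S) \<noteq> {}"
          then obtain i k where "i \<in> S" "k \<in> I - S" "R1 i = R2 k" by auto
          then show False using R1U[of i] R2(2)[rule_format, of k] by simp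
        qed
        from inj_on_disjoint_Un[OF R1(1) R2(1) this] show ?thesis
          using S by (simp add: Un_absorb1 psubset_imp_subset)
      qed
      moreover have "\<forall>i\<in>I. ?R i \<in> A i" using R1 R2 by auto
      ultimately show ?thesis by (rule_tac exI[of _ ?R]) blast
    next
      case False
      then have strict: "card S < card (\<Union>i\<in>S. A i)" if "S \<subset> I" "S \<noteq> {}" for S
        using that by (meson not_le)
      obtain i where i: "i \<in> I" using \<open>I \<noteq> {}\<close> by blast
      have "card {i} \<le> card (\<Union>k\<in>{i}. A k)" using hall i by blast
      then obtain a where a: "a \<in> A i" by fastforce
      have "card (I - {i}) < card I" using i finI by (meson card_Diff1_less)
      moreover have "card T \<le> card (\<Union>k\<in>T. A k - {a})" if T: "T \<subseteq> I - {i}" for T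
      proof (cases "T = {}")
        case False
        have "card T < card (\<Union>k\<in>T. A k)" using strict[of T] T i False by blast
        moreover have eq: "(\<Union>k\<in>T. A k - {a}) = (\<Union>k\<in>T. A k) - {a}" by auto
        moreover have "card (\<Union>k\<in>T. A k) - 1 \<le> card ((\<Union>k\<in>T. A k) - {a})"
          by (simp add: card_Diff_singleton_if)
        ultimately show ?thesis unfolding eq by linarith
      qed simp
      ultimately obtain R where R: "inj_on R (I - {i})" "\<forall>k\<in>I - {i}. R k \<in> A k - {a}"
        using less.hyps[of "I - {i}" "\<lambda>k. A k - {a}"] finI finA by (metis Diff_iff finite_Diff)
      have "inj_on (R(i := a)) I"
        using R unfolding inj_on_def by auto
      moreover have "\<forall>k\<in>I. (R(i := a)) k \<in> A k" using R a by auto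
      ultimately show ?thesis by blast
    qed
  qed auto
qed

section \<open>Minimizers on the coordinate simplex\<close>

lemma continuous_on_Max_family:
  fixes f :: "'k \<Rightarrow> 'a::topological_space \<Rightarrow> real"
  assumes "finite K" "K \<noteq> {}" "\<And>k. k \<in> K \<Longrightarrow> continuous_on X (f k)"
  shows "continuous_on X (\<lambda>x. Max ((\<lambda>k. f k x) ` K))"
  using assms
proof (induction K rule: finite_ne_induct)
  case (insert k K)
  then have "(\<lambda>x. Max ((\<lambda>k. f k x) ` insert k K)) = (\<lambda>x. max (f k x) (Max ((\<lambda>k. f k x) ` K)))"
    by (auto simp: fun_eq_iff)
  then show ?case using insert by (auto intro!: continuous_intros)
qed simp

text \<open>The set is a closed part of a product of copies of \<open>{0..1}\<close> and
  \<open>{0}\<close>, which is compact by Tychonoff. Pinning the coordinates outside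
  \<open>J\<close> to 0 keeps it compact in the space of functions on the whole index type.\<close>

lemma compact_coordinate_simplex:
  fixes J :: "'j set"
  assumes "finite J"
  shows "compact {x :: 'j \<Rightarrow> real. (\<forall>k\<in>J. 0 \<le> x k) \<and> (\<forall>k. k \<notin> J \<longrightarrow> x k = 0) \<and> sum x J = 1}"
    (is "compact ?X")
proof -
  let ?B = "PiE UNIV (\<lambda>k. if k \<in> J then {0..1} else {0::real})"
  have "compactin (product_topology (\<lambda>_. euclidean) UNIV) ?B"
    by (subst compactin_PiE) auto
  then have "compact ?B"
    by (simp add: euclidean_product_topology)
  moreover have "closed {x :: 'j \<Rightarrow> real. sum x J = 1}"
    by (intro closed_Collect_eq continuous_intros continuous_on_product_coordinates)
  moreover have "?X = ?B \<inter> {x. sum x J = 1}"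
  proof -
    have "x k \<le> 1" if "x \<in> ?X" "k \<in> J" for x k
      using member_le_sum[of k J x] that assms by simp
    then show ?thesis by (auto simp: PiE_iff split: if_splits)
  qed
  ultimately show ?thesis by (simp add: compact_Int_closed)
qed

text \<open>The point minimizes the sum of the \<open>m i x\<close>. If some agents \<open>S\<close>
  accepted at most \<open>card S\<close> pieces, moving weight from the pieces they reject to those
  they accept would lower this sum. The strict inequality is a surplus that survives the removal of
  any single piece.\<close>

lemma exists_point_with_large_neighbourhoods:
  fixes b :: "'i \<Rightarrow> 'j \<Rightarrow> real"
  assumes finI: "finite I" and finJ: "finite J" and cardJ: "card J = Suc (card I)"
    and b0: "\<And>i k. i \<in> I \<Longrightarrow> k \<in> J \<Longrightarrow> 0 \<le> b i k"
    and b1: "\<And>i. i \<in> I \<Longrightarrow> 1 \<le> (\<Sum>k\<in>J. b i k)"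
  shows "\<exists>x. (\<forall>k\<in>J. 0 \<le> x k) \<and> (\<forall>k. k \<notin> J \<longrightarrow> x k = 0) \<and> sum x J = 1 \<and>
    (\<forall>S\<subseteq>I. S \<noteq> {} \<longrightarrow> card S < card {k \<in> J. \<exists>i\<in>S. x k \<le> b i k})"
proof -
  let ?X = "{x :: 'j \<Rightarrow> real. (\<forall>k\<in>J. 0 \<le> x k) \<and> (\<forall>k. k \<notin> J \<longrightarrow> x k = 0) \<and> sum x J = 1}"
  define m where "m i x = Max ((\<lambda>k. b i k - x k) ` J)" for i x
  have neJ: "J \<noteq> {}" using cardJ by auto
  then obtain k0 where k0: "k0 \<in> J" by blast
  have m_ge: "b i k - x k \<le> m i x" if "k \<in> J" for i k x
    unfolding m_def using that finJ by simp
  have m_le: "m i x \<le> c" if "\<And>k. k \<in> J \<Longrightarrow> b i k - x k \<le> c" for i x c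
    unfolding m_def using that finJ neJ by simp
  have "(\<lambda>k. if k = k0 then 1 else 0) \<in> ?X"
    using k0 finJ by (auto simp: sum.delta)
  then have neX: "?X \<noteq> {}" by (rule ex_in_conv[THEN iffD1, OF exI])
  have "continuous_on ?X (\<lambda>x. \<Sum>i\<in>I. m i x)"
    unfolding m_def
    by (intro continuous_on_sum continuous_on_Max_family finJ neJ continuous_on_diff
        continuous_on_const continuous_on_subset[OF continuous_on_product_coordinates subset_UNIV])
  from continuous_attains_inf[OF compact_coordinate_simplex[OF finJ] neX this]
  obtain x where x: "x \<in> ?X" and minimal: "\<forall>y\<in>?X. (\<Sum>i\<in>I. m i x) \<le> (\<Sum>i\<in>I. m i y)" ..
  \<comment> \<open>A negative maximum would make \<open>x\<close> exceed \<open>b i\<close> in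
    every coordinate, although \<open>x\<close> sums to 1 and \<open>b i\<close> to at least
    1.\<close>
  have m_nonneg: "0 \<le> m i x" if "i \<in> I" for i
  proof (rule ccontr)
    assume "\<not> 0 \<le> m i x"
    then have "(\<Sum>k\<in>J. b i k) < sum x J"
      using m_ge[of _ i x] finJ neJ by (intro sum_strict_mono) (smt (verit))+
    then show False using b1[OF that] x by simp
  qed
  have "card S < card {k \<in> J. \<exists>i\<in>S. x k \<le> b i k}" if S: "S \<subseteq> I" "S \<noteq> {}" for S
  proof (rule ccontr)
    define N where "N = {k \<in> J. \<exists>i\<in>S. x k \<le> b i k}"
    define C where "C = J - N"
    assume "\<not> card S < card {k \<in> J. \<exists>i\<in>S. x k \<le> b i k}"
    then have NS: "card N \<le> card S" unfolding N_def by simp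
    have finS: "finite S" using S finI finite_subset by blast
    have finN: "finite N" and finC: "finite C" and NJ: "N \<subseteq> J"
      unfolding N_def C_def using finJ by auto
    have cI: "card I = card S + card (I - S)"
      using S finI finS by (metis card_Diff_subset card_mono le_add_diff_inverse)
    have cJ: "card J = card N + card C"
      unfolding C_def using NJ finJ finN by (metis card_Diff_subset card_mono le_add_diff_inverse)
    \<comment> \<open>\<open>J\<close> has exactly one element more than \<open>I\<close>, so a
      small \<open>N\<close> leaves a complement \<open>C\<close> larger than
      \<open>I - S\<close>.\<close>
    have CI: "card (I - S) < card C" using cI cJ NS cardJ by linarith
    then have C_pos: "0 < card C" by simp
    then have neC: "C \<noteq> {}" by auto
    obtain i0 where i0: "i0 \<in> S" using S by blast
    have neN: "N \<noteq> {}"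
    proof
      assume "N = {}"
      then have "\<And>k. k \<in> J \<Longrightarrow> b i0 k < x k" unfolding N_def using i0 by fastforce
      moreover have "m i0 x \<in> (\<lambda>k. b i0 k - x k) ` J"
        unfolding m_def using finJ neJ by (intro Max_in) auto
      ultimately show False using m_nonneg[of i0] S i0 by fastforce
    qed
    then have N_pos: "0 < card N" using finN by (simp add: card_gt_0_iff)
    \<comment> \<open>Half of the smallest gap: on \<open>C\<close> the difference
      \<open>b i k - x k\<close> is at most \<open>- 2 * \<delta>\<close>, so after a rise by
      \<open>q \<le> \<delta>\<close> it still lies below \<open>- p\<close>. The same gap keeps the
      shifted point nonnegative.\<close>
    define \<delta> where "\<delta> = Min ((\<lambda>(i, k). (x k - b i k) / 2) ` (S \<times> C))"
    have "\<delta> \<in> (\<lambda>(i, k). (x k - b i k) / 2) ` (S \<times> C)"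
      unfolding \<delta>_def using finS finC S neC by (intro Min_in) auto
    then obtain i k where ik: "i \<in> S" "k \<in> C" and "\<delta> = (x k - b i k) / 2" by auto
    moreover have "b i k < x k" using ik unfolding C_def N_def by (auto simp: not_le)
    ultimately have \<delta>_pos: "0 < \<delta>" by simp
    have \<delta>_le: "2 * \<delta> \<le> x k - b i k" if "i \<in> S" "k \<in> C" for i k
    proof -
      have "\<delta> \<le> (x k - b i k) / 2"
        unfolding \<delta>_def using finS finC that by (intro Min_le) (auto intro!: image_eqI[of _ _ "(i, k)"])
      then show ?thesis by simp
    qed
    \<comment> \<open>Shifting weight \<open>\<delta>\<close> from \<open>C\<close> to \<open>N\<close> lowers \<open>m i x\<close> by \<open>p\<close> for \<open>i \<in> S\<close> and raises the other
        summands by at most \<open>q\<close>; since \<open>card N \<le> card S\<close>, the total decreases.\<close>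
    define p where "p = \<delta> / card N"
    define q where "q = \<delta> / card C"
    have pq: "0 < p" "p \<le> \<delta>" "0 < q" "q \<le> \<delta>"
      unfolding p_def q_def using N_pos C_pos \<delta>_pos by (auto simp: divide_simps)
    define y where "y k = (if k \<in> N then x k + p else if k \<in> C then x k - q else 0)" for k
    have "sum y J = sum y N + sum y C"
      unfolding C_def using NJ finJ by (metis add.commute sum.subset_diff)
    also have "sum y N = sum x N + \<delta>"
      using N_pos by (simp add: y_def sum.distrib p_def)
    also have "sum y C = (\<Sum>k\<in>C. x k - q)"
      by (intro sum.cong) (auto simp: y_def C_def)
    also have "\<dots> = sum x C - \<delta>"
      using C_pos by (simp add: sum_subtractf q_def)
    also have "sum x N + \<delta> + (sum x C - \<delta>) = sum x J"
      unfolding C_def using NJ finJ by (simp add: sum.subset_diff[of N J x])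
    finally have sumy: "sum y J = 1" using x by simp
    have "0 \<le> y k" if "k \<in> J" for k
    proof (cases "k \<in> N")
      case False
      then have "k \<in> C" using that C_def by simp
      then show ?thesis using \<delta>_le[OF i0] b0[of i0 k] i0 S that False pq \<delta>_pos by (fastforce simp: y_def)
    qed (use x that pq in \<open>auto simp: y_def\<close>)
    then have yX: "y \<in> ?X"
      using sumy NJ by (auto simp: y_def C_def)
    have decr: "m i y \<le> m i x - p" if "i \<in> S" for i
    proof (rule m_le)
      fix k assume k: "k \<in> J"
      show "b i k - y k \<le> m i x - p"
      proof (cases "k \<in> N")
        case True
        then show ?thesis using m_ge[OF k, of i x] by (simp add: y_def)
      next
        case False
        then have "k \<in> C" using k C_def by simp
        then show ?thesis using \<delta>_le[OF that] m_nonneg[of i] S that False pq by (fastforce simp: y_def)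
      qed
    qed
    have incr: "m i y \<le> m i x + q" for i
    proof (rule m_le)
      fix k assume k: "k \<in> J"
      then show "b i k - y k \<le> m i x + q"
        using m_ge[OF k, of i x] pq by (auto simp: y_def C_def)
    qed
    have "(\<Sum>i\<in>I. m i y) = (\<Sum>i\<in>I - S. m i y) + (\<Sum>i\<in>S. m i y)"
      using S finI by (simp add: sum.subset_diff)
    also have "\<dots> \<le> (\<Sum>i\<in>I - S. m i x + q) + (\<Sum>i\<in>S. m i x - p)"
      by (intro add_mono sum_mono incr decr)
    also have "\<dots> = (\<Sum>i\<in>I. m i x) + card (I - S) * q - card S * p"
      using S finI by (simp add: sum.subset_diff[of S I] sum.distrib sum_subtractf)
    also have "\<dots> < (\<Sum>i\<in>I. m i x)"
    proof -
      have "card (I - S) * q < card C * q" using CI pq by simp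
      also have "\<dots> = card N * p" unfolding p_def q_def using N_pos C_pos by simp
      also have "\<dots> \<le> card S * p" using NS pq by simp
      finally show ?thesis by simp
    qed
    finally show False using bspec[OF minimal yX] by simp
  qed
  with x show ?thesis by blast
qed

section \<open>Barycentric coordinates\<close>

text \<open>Vanishing outside \<open>{1..d}\<close> matches the normalization in
  \<open>barycentric\<close>, so that for regular vertices each point of the simplex has exactly one
  such coordinate function.\<close>

definition bary_coords :: "nat \<Rightarrow> (nat \<Rightarrow> real) set" where
  "bary_coords d =
     {\<alpha>. (\<forall>i\<in>{1..d}. 0 \<le> \<alpha> i) \<and> (\<forall>i. i \<notin> {1..d} \<longrightarrow> \<alpha> i = 0) \<and> (\<Sum>i=1..d. \<alpha> i) = 1}"

definition bary_point :: "nat \<Rightarrow> (nat \<Rightarrow> 'a::euclidean_space) \<Rightarrow> (nat \<Rightarrow> real) \<Rightarrow> 'a" where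
  "bary_point d v \<alpha> = (\<Sum>i=1..d. \<alpha> i *\<^sub>R v i)"

lemma inner_eq_dist:
  fixes x y :: "'a::real_inner"
  shows "x \<bullet> y = (x \<bullet> x + y \<bullet> y - (dist x y)\<^sup>2) / 2"
  by (simp add: dist_norm power2_norm_eq_inner inner_diff inner_commute)

text \<open>Unit distances determine the inner products of the vertices from their norms. Expanding
  the squared norm of the vanishing combination, all terms with norms cancel because the
  coefficients sum to 0, and half the sum of their squares remains.\<close>

lemma regular_unit_simplex_affine_independent:
  fixes v :: "nat \<Rightarrow> 'a::euclidean_space"
  assumes reg: "regular_unit_simplex_vertices d v"
    and sum0: "(\<Sum>i=1..d. \<beta> i) = 0" and comb0: "(\<Sum>i=1..d. \<beta> i *\<^sub>R v i) = 0"
    and k: "k \<in> {1..d}"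
  shows "\<beta> k = 0"
proof -
  let ?I = "{1..d}"
  have inner: "v i \<bullet> v j = (v i \<bullet> v i + v j \<bullet> v j - 1 + (if i = j then 1 else 0)) / 2"
    if "i \<in> ?I" "j \<in> ?I" for i j
  proof (cases "i = j")
    case False
    then have "dist (v i) (v j) = 1"
      using reg that unfolding regular_unit_simplex_vertices_def by blast
    then show ?thesis using False inner_eq_dist[of "v i" "v j"] by simp
  qed simp
  have "0 = (\<Sum>i\<in>?I. \<beta> i *\<^sub>R v i) \<bullet> (\<Sum>j\<in>?I. \<beta> j *\<^sub>R v j)"
    using comb0 by simp
  also have "\<dots> = (\<Sum>i\<in>?I. \<Sum>j\<in>?I. \<beta> i * \<beta> j * (v i \<bullet> v j))"
    unfolding inner_sum_left inner_sum_right
    by (rule trans[OF sum.swap]) (simp add: mult_ac)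
  \<comment> \<open>The first summand vanishes on summing over \<open>j\<close>, the second on
    summing over \<open>i\<close>; the third is the diagonal.\<close>
  also have "\<dots> = (\<Sum>i\<in>?I. \<Sum>j\<in>?I. (\<beta> i * (v i \<bullet> v i - 1) / 2) * \<beta> j + \<beta> i / 2 * (\<beta> j * (v j \<bullet> v j))
      + (if j = i then \<beta> i * \<beta> j / 2 else 0))"
    by (intro sum.cong refl) (subst inner; auto simp: field_simps)
  also have "\<dots> = (\<Sum>i\<in>?I. (\<beta> i * (v i \<bullet> v i - 1) / 2) * sum \<beta> ?I)
      + (\<Sum>i\<in>?I. \<beta> i * (\<Sum>j\<in>?I. \<beta> j * (v j \<bullet> v j))) / 2 + (\<Sum>i\<in>?I. \<beta> i * \<beta> i / 2)"
    by (simp add: sum.distrib sum_distrib_left sum_divide_distrib)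
  also have "\<dots> = (\<Sum>i\<in>?I. \<beta> i * \<beta> i / 2)"
    using sum0 by (simp flip: sum_distrib_right)
  finally have "(\<Sum>i\<in>?I. \<beta> i * \<beta> i / 2) = 0" by simp
  then have "\<forall>i\<in>?I. \<beta> i * \<beta> i / 2 = 0"
    by (subst (asm) sum_nonneg_eq_0_iff) auto
  then show ?thesis using k by simp
qed

lemma barycentric_bary_point:
  fixes v :: "nat \<Rightarrow> 'a::euclidean_space"
  assumes reg: "regular_unit_simplex_vertices d v" and \<alpha>: "\<alpha> \<in> bary_coords d"
  shows "barycentric d v (bary_point d v \<alpha>) = \<alpha>"
  unfolding barycentric_def
proof (rule the_equality)
  show "(\<forall>i. i \<notin> {1..d} \<longrightarrow> \<alpha> i = 0) \<and> (\<Sum>i=1..d. \<alpha> i) = 1 \<and>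
      bary_point d v \<alpha> = (\<Sum>i=1..d. \<alpha> i *\<^sub>R v i)"
    using \<alpha> by (simp add: bary_coords_def bary_point_def)
next
  fix \<gamma> assume \<gamma>: "(\<forall>i. i \<notin> {1..d} \<longrightarrow> \<gamma> i = 0) \<and> (\<Sum>i=1..d. \<gamma> i) = 1 \<and>
      bary_point d v \<alpha> = (\<Sum>i=1..d. \<gamma> i *\<^sub>R v i)"
  have "\<gamma> k - \<alpha> k = 0" if "k \<in> {1..d}" for k
    by (rule regular_unit_simplex_affine_independent[OF reg _ _ that])
      (use \<alpha> \<gamma> in \<open>auto simp: bary_coords_def bary_point_def sum_subtractf scaleR_diff_left\<close>)
  moreover have "\<gamma> k - \<alpha> k = 0" if "k \<notin> {1..d}" for k
    using \<alpha> \<gamma> that by (simp add: bary_coords_def)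
  ultimately have "\<gamma> k = \<alpha> k" for k by fastforce
  then show "\<gamma> = \<alpha>" ..
qed

lemma convex_bary_point_image: "convex (bary_point d v ` bary_coords d)"
proof (rule convexI)
  fix x y and s t :: real
  assume "x \<in> bary_point d v ` bary_coords d" "y \<in> bary_point d v ` bary_coords d"
    and st: "0 \<le> s" "0 \<le> t" "s + t = 1"
  then obtain \<alpha> \<beta> where "\<alpha> \<in> bary_coords d" "\<beta> \<in> bary_coords d"
      and xy: "x = bary_point d v \<alpha>" "y = bary_point d v \<beta>" by blast
  then have "(\<lambda>i. s * \<alpha> i + t * \<beta> i) \<in> bary_coords d"
    using st by (auto simp: bary_coords_def sum.distrib simp flip: sum_distrib_left)
  moreover have "s *\<^sub>R x + t *\<^sub>R y = bary_point d v (\<lambda>i. s * \<alpha> i + t * \<beta> i)"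
    by (simp add: xy bary_point_def scaleR_sum_right scaleR_add_left sum.distrib)
  ultimately show "s *\<^sub>R x + t *\<^sub>R y \<in> bary_point d v ` bary_coords d" by blast
qed

lemma bary_point_vertex:
  assumes "k \<in> {1..d}"
  shows "(\<lambda>i. if i = k then 1 else 0) \<in> bary_coords d"
    and "bary_point d v (\<lambda>i. if i = k then 1 else 0) = v k"
  using assms by (auto simp: bary_coords_def bary_point_def if_distrib[of "\<lambda>c. c *\<^sub>R _"] cong: if_cong)

lemma vertex_simplex_eq: "vertex_simplex d v = bary_point d v ` bary_coords d"
proof
  have "v ` {1..d} \<subseteq> bary_point d v ` bary_coords d"
    using bary_point_vertex by (metis (no_types, lifting) image_eqI image_subsetI)
  then show "vertex_simplex d v \<subseteq> bary_point d v ` bary_coords d"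
    unfolding vertex_simplex_def by (intro hull_minimal convex_bary_point_image)
  show "bary_point d v ` bary_coords d \<subseteq> vertex_simplex d v"
  proof (rule image_subsetI)
    fix \<alpha> assume "\<alpha> \<in> bary_coords d"
    then show "bary_point d v \<alpha> \<in> vertex_simplex d v"
      unfolding vertex_simplex_def bary_coords_def bary_point_def
      by (intro convex_sum convex_convex_hull) (auto intro: hull_inc)
  qed
qed

lemma bary_point_in_simplex: "\<alpha> \<in> bary_coords d \<Longrightarrow> bary_point d v \<alpha> \<in> vertex_simplex d v"
  by (simp add: vertex_simplex_eq)

section \<open>Preference sets as sublevel sets of one coordinate\<close>

definition threshold_set ::
    "nat \<Rightarrow> (nat \<Rightarrow> 'a::euclidean_space) \<Rightarrow> nat \<Rightarrow> real \<Rightarrow> 'a set" where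
  "threshold_set d v j t = bary_point d v ` {\<alpha> \<in> bary_coords d. \<alpha> j \<le> t}"

lemma bary_point_in_threshold_set_iff:
  assumes "regular_unit_simplex_vertices d v" "\<alpha> \<in> bary_coords d"
  shows "bary_point d v \<alpha> \<in> threshold_set d v j t \<longleftrightarrow> \<alpha> j \<le> t"
proof
  assume "bary_point d v \<alpha> \<in> threshold_set d v j t"
  then obtain \<beta> where \<beta>: "\<beta> \<in> bary_coords d" "\<beta> j \<le> t" "bary_point d v \<alpha> = bary_point d v \<beta>"
    unfolding threshold_set_def by (elim imageE CollectE conjE)
  then have "\<alpha> = \<beta>"
    using barycentric_bary_point[OF assms] barycentric_bary_point[OF assms(1) \<beta>(1)] by metis
  then show "\<alpha> j \<le> t" using \<beta>(2) by metis
next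
  assume "\<alpha> j \<le> t"
  then show "bary_point d v \<alpha> \<in> threshold_set d v j t"
    unfolding threshold_set_def by (intro imageI CollectI conjI assms(2))
qed

text \<open>The functional \<open>a\<close> is constant on the affine hull of the facet, so on the
  simplex it equals \<open>c + \<alpha> j * e\<close>. Containing the facet gives
  \<open>c \<le> b\<close>, hence \<open>0 \<le> t\<close>; properness forces \<open>0 < e\<close>
  and \<open>b < c + e\<close>, hence \<open>t < 1\<close>.\<close>

lemma halfspace_set_eq_threshold_set:
  fixes v :: "nat \<Rightarrow> 'a::euclidean_space"
  assumes d: "2 \<le> d" and j: "j \<in> {1..d}"
    and par: "affine_parallel {x. a \<bullet> x = b} (affine hull (facet d v j))"
    and S: "S = vertex_simplex d v \<inter> {x. a \<bullet> x \<le> b}"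
    and proper: "S \<subset> vertex_simplex d v" and facet: "facet d v j \<subseteq> S"
  shows "\<exists>t. 0 \<le> t \<and> t < 1 \<and> S = threshold_set d v j t"
proof -
  \<comment> \<open>A vertex of the facet, available since \<open>2 \<le> d\<close>; it lies in
    \<open>S\<close>, which yields \<open>c \<le> b\<close>.\<close>
  define k0 where "k0 = (if j = 1 then 2 else 1 :: nat)"
  have k0: "k0 \<in> {1..d} - {j}" using d j by (auto simp: k0_def)
  obtain u where u: "affine hull (facet d v j) = (\<lambda>x. u + x) ` {x. a \<bullet> x = b}"
    using par unfolding affine_parallel_def by blast
  define c where "c = a \<bullet> u + b"
  have vfacet: "v k \<in> facet d v j" if "k \<in> {1..d} - {j}" for k
    unfolding facet_def using that by (intro hull_inc) blast
  have vc: "a \<bullet> v k = c" if "k \<in> {1..d} - {j}" for k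
  proof -
    have "v k \<in> affine hull (facet d v j)" using vfacet[OF that] by (rule hull_inc)
    then show ?thesis unfolding u c_def by (auto simp: inner_add_right)
  qed
  define e where "e = a \<bullet> v j - c"
  have inner: "a \<bullet> bary_point d v \<alpha> = c + \<alpha> j * e" if \<alpha>: "\<alpha> \<in> bary_coords d" for \<alpha>
  proof -
    have "a \<bullet> bary_point d v \<alpha> = (\<Sum>k=1..d. \<alpha> k * (a \<bullet> v k))"
      by (simp add: bary_point_def inner_sum_right)
    also have "\<dots> = (\<Sum>k=1..d. \<alpha> k * c + (if k = j then \<alpha> j * e else 0))"
      using vc by (intro sum.cong refl) (auto simp: e_def algebra_simps)
    also have "\<dots> = c + \<alpha> j * e"
      using j \<alpha> by (simp add: sum.distrib bary_coords_def flip: sum_distrib_right)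
    finally show ?thesis .
  qed
  have cb: "c \<le> b" using vc[OF k0] vfacet[OF k0] facet S by auto
  obtain \<alpha> where \<alpha>: "\<alpha> \<in> bary_coords d" and "bary_point d v \<alpha> \<notin> S"
    using proper unfolding vertex_simplex_eq by blast
  then have gt: "b < c + \<alpha> j * e"
    using inner[OF \<alpha>] unfolding S by (simp add: bary_point_in_simplex)
  have "0 \<le> \<alpha> j" "\<alpha> j \<le> 1"
    using \<alpha> j member_le_sum[of j "{1..d}" \<alpha>] by (auto simp: bary_coords_def)
  moreover from this have "0 < e" using gt cb by (smt (verit) mult_nonneg_nonpos)
  ultimately have "0 < e" and "b < c + e"
    using gt mult_right_mono[of "\<alpha> j" 1 e] by linarith+
  define t where "t = (b - c) / e"
  have "0 \<le> t" "t < 1" unfolding t_def using \<open>0 < e\<close> \<open>b < c + e\<close> cb by auto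
  moreover have "S = threshold_set d v j t"
  proof -
    have "S = bary_point d v ` {\<alpha> \<in> bary_coords d. a \<bullet> bary_point d v \<alpha> \<le> b}"
      unfolding S vertex_simplex_eq by blast
    also have "{\<alpha> \<in> bary_coords d. a \<bullet> bary_point d v \<alpha> \<le> b} = {\<alpha> \<in> bary_coords d. \<alpha> j \<le> t}"
      using inner \<open>0 < e\<close> by (intro Collect_cong conj_cong refl) (simp add: t_def field_simps)
    finally show ?thesis unfolding threshold_set_def .
  qed
  ultimately show ?thesis by blast
qed

text \<open>If the thresholds summed to less than 1, raising each by an equal share of the deficit
  would give a point of the simplex outside all the sets.\<close>

lemma sum_thresholds_ge_1:
  fixes v :: "nat \<Rightarrow> 'a::euclidean_space"
  assumes reg: "regular_unit_simplex_vertices d v" and "1 \<le> d"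
    and t0: "\<And>j. j \<in> {1..d} \<Longrightarrow> 0 \<le> t j"
    and cover: "(\<Union>j\<in>{1..d}. threshold_set d v j (t j)) = vertex_simplex d v"
  shows "1 \<le> (\<Sum>j=1..d. t j)"
proof (rule ccontr)
  assume less: "\<not> 1 \<le> (\<Sum>j=1..d. t j)"
  define r where "r = (1 - (\<Sum>j=1..d. t j)) / d"
  have r: "0 < r" using less \<open>1 \<le> d\<close> by (simp add: r_def)
  define \<alpha> where "\<alpha> j = (if j \<in> {1..d} then t j + r else 0)" for j
  have "(\<Sum>j=1..d. \<alpha> j) = (\<Sum>j=1..d. t j + r)"
    by (intro sum.cong) (auto simp: \<alpha>_def)
  also have "\<dots> = 1"
    using \<open>1 \<le> d\<close> by (simp add: sum.distrib r_def)
  finally have \<alpha>: "\<alpha> \<in> bary_coords d"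
    using t0 r by (auto simp: bary_coords_def \<alpha>_def)
  then obtain j where "j \<in> {1..d}" "bary_point d v \<alpha> \<in> threshold_set d v j (t j)"
    using bary_point_in_simplex[OF \<alpha>, of v] cover by blast
  then show False
    using bary_point_in_threshold_set_iff[OF reg \<alpha>] r by (auto simp: \<alpha>_def)
qed

text \<open>The excess \<open>h\<close> of coordinate \<open>j\<close> over \<open>t\<close> is
  moved to another coordinate \<open>k\<close>. Only two coordinates change, each by
  \<open>h \<le> \<epsilon>\<close>, so the max-distance is at most \<open>\<epsilon>\<close>;
  nonnegativity of \<open>t\<close> keeps the new point in the simplex.\<close>

lemma threshold_set_enlargement:
  fixes v :: "nat \<Rightarrow> 'a::euclidean_space"
  assumes reg: "regular_unit_simplex_vertices d v" and d: "2 \<le> d" and j: "j \<in> {1..d}"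
    and \<alpha>: "\<alpha> \<in> bary_coords d" and "\<alpha> j \<le> t + \<epsilon>" "0 \<le> t" "0 \<le> \<epsilon>"
  shows "bary_point d v \<alpha> \<in> enlargement d v \<epsilon> (threshold_set d v j t)"
proof -
  define k where "k = (if j = 1 then 2 else 1 :: nat)"
  have k: "k \<in> {1..d}" "k \<noteq> j" using d j by (auto simp: k_def)
  define h where "h = max 0 (\<alpha> j - t)"
  define \<beta> where "\<beta> = \<alpha>(j := \<alpha> j - h, k := \<alpha> k + h)"
  have h: "0 \<le> h" "h \<le> \<epsilon>" "\<alpha> j - h \<le> t" unfolding h_def using assms by auto
  have \<alpha>0: "\<And>i. i \<in> {1..d} \<Longrightarrow> 0 \<le> \<alpha> i" using \<alpha> by (simp add: bary_coords_def)
  have "(\<Sum>i=1..d. \<beta> i) = (\<Sum>i=1..d. \<alpha> i - (if i = j then h else 0) + (if i = k then h else 0))"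
    using k by (intro sum.cong) (auto simp: \<beta>_def)
  also have "\<dots> = 1"
    using j k \<alpha> by (simp add: sum.distrib sum_subtractf bary_coords_def)
  finally have \<beta>: "\<beta> \<in> bary_coords d"
    using \<alpha> \<alpha>0[OF j] \<alpha>0[OF k(1)] h j k \<open>0 \<le> t\<close> unfolding bary_coords_def by (auto simp: \<beta>_def h_def)
  have dist: "bary_dist d v (bary_point d v \<alpha>) (bary_point d v \<beta>) \<le> \<epsilon>"
    unfolding bary_dist_def barycentric_bary_point[OF reg \<alpha>] barycentric_bary_point[OF reg \<beta>]
    using d h k \<open>0 \<le> \<epsilon>\<close> by (auto simp: \<beta>_def)
  have mem: "bary_point d v \<beta> \<in> threshold_set d v j t"
    using bary_point_in_threshold_set_iff[OF reg \<beta>] h k by (simp add: \<beta>_def)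
  have "0 \<le> bary_dist d v x y" for x y :: 'a
    unfolding bary_dist_def using d by (subst Max_ge_iff) auto
  then have "bdd_below ((bary_dist d v (bary_point d v \<alpha>)) ` threshold_set d v j t)"
    by (intro bdd_belowI2[where m = 0])
  from cINF_lower[OF this mem] dist
  have "(INF y\<in>threshold_set d v j t. bary_dist d v (bary_point d v \<alpha>) y) \<le> \<epsilon>"
    by linarith
  with mem show ?thesis unfolding enlargement_def by blast
qed

section \<open>Learning the thresholds\<close>

text \<open>Decision trees have no sequential composition, so the rest of the algorithm enters as a
  continuation \<open>K\<close> of the lower endpoint found.\<close>

primrec bisect ::
    "(real \<Rightarrow> 'a) \<Rightarrow> nat \<Rightarrow> nat \<Rightarrow> nat \<Rightarrow> real \<Rightarrow> real \<Rightarrow> (real \<Rightarrow> 'a binary_algorithm) \<Rightarrow> 'a binary_algorithm"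
  where
  "bisect q i j 0 lo h K = K lo"
| "bisect q i j (Suc m) lo h K =
     Query i j (q (lo + h / 2)) (bisect q i j m (lo + h / 2) (h / 2) K) (bisect q i j m lo (h / 2) K)"

text \<open>The invariant is \<open>lo \<le> t < lo + h\<close>. The half-open interval fits the
  answers: "yes" at the midpoint means that it is at most \<open>t\<close>, "no" that it exceeds
  \<open>t\<close>.\<close>

lemma bisect_correct:
  assumes "\<And>s. 0 \<le> s \<Longrightarrow> s \<le> 1 \<Longrightarrow> q s \<in> P i j \<longleftrightarrow> s \<le> t"
    and "0 \<le> lo" "0 \<le> h" "lo + h \<le> 1" "lo \<le> t" "t < lo + h"
  shows "\<exists>s. s \<le> t \<and> t < s + h / 2 ^ m \<and>
    result P (bisect q i j m lo h K) = result P (K s) \<and>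
    query_count P (bisect q i j m lo h K) = m + query_count P (K s)"
  using assms(2-)
proof (induction m arbitrary: lo h)
  case (Suc m)
  have mid: "q (lo + h / 2) \<in> P i j \<longleftrightarrow> lo + h / 2 \<le> t"
    using Suc.prems by (intro assms(1)) auto
  show ?case
  proof (cases "lo + h / 2 \<le> t")
    case True
    then show ?thesis using Suc.IH[of "lo + h / 2" "h / 2"] Suc.prems mid by simp
  next
    case False
    then show ?thesis using Suc.IH[of lo "h / 2"] Suc.prems mid by simp
  qed
qed auto

lemma admissible_bisect:
  assumes "i \<in> {1..d}" "j \<in> {1..d}"
    and "\<And>s. 0 \<le> s \<Longrightarrow> s \<le> 1 \<Longrightarrow> q s \<in> vertex_simplex d v"
    and "\<And>s. admissible d v (K s)"
    and "0 \<le> lo" "0 \<le> h" "lo + h \<le> 1"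
  shows "admissible d v (bisect q i j m lo h K)"
  using assms(5-)
proof (induction m arbitrary: lo h)
  case (Suc m)
  then show ?case using assms(1-3) by simp
qed (use assms(4) in auto)

primrec learn_thresholds ::
    "(nat \<Rightarrow> real \<Rightarrow> 'a) \<Rightarrow> nat \<Rightarrow> ((nat \<times> nat \<Rightarrow> real) \<Rightarrow> 'a) \<Rightarrow> (nat \<times> nat) list \<Rightarrow>
      (nat \<times> nat \<Rightarrow> real) \<Rightarrow> 'a binary_algorithm"
  where
  "learn_thresholds q m f [] c = Output (f c)"
| "learn_thresholds q m f (p # ps) c =
     bisect (q (snd p)) (fst p) (snd p) m 0 1 (\<lambda>s. learn_thresholds q m f ps (c(p := s)))"

lemma learn_thresholds_correct:
  assumes "\<And>i j s. (i, j) \<in> set ps \<Longrightarrow> 0 \<le> s \<Longrightarrow> s \<le> 1 \<Longrightarrow> q j s \<in> P i j \<longleftrightarrow> s \<le> t i j"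
    and "\<And>i j. (i, j) \<in> set ps \<Longrightarrow> 0 \<le> t i j \<and> t i j < 1"
    and "distinct ps"
  shows "\<exists>c'. (\<forall>p. p \<notin> set ps \<longrightarrow> c' p = c p) \<and>
    (\<forall>(i, j)\<in>set ps. c' (i, j) \<le> t i j \<and> t i j < c' (i, j) + 1 / 2 ^ m) \<and>
    result P (learn_thresholds q m f ps c) = f c' \<and>
    query_count P (learn_thresholds q m f ps c) = length ps * m"
  using assms
proof (induction ps arbitrary: c)
  case (Cons p ps)
  obtain i j where p: "p = (i, j)" by fastforce
  have "q j s \<in> P i j \<longleftrightarrow> s \<le> t i j" if "0 \<le> s" "s \<le> 1" for s
    using Cons.prems(1) that p by simp
  from bisect_correct[where q = "q j" and P = P and i = i and j = j and t = "t i j" and lo = 0 and h = 1 and m = m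
      and K = "\<lambda>s. learn_thresholds q m f ps (c(p := s))", OF this]
  obtain s where s: "s \<le> t i j" "t i j < s + 1 / 2 ^ m"
    "result P (learn_thresholds q m f (p # ps) c) = result P (learn_thresholds q m f ps (c(p := s)))"
    "query_count P (learn_thresholds q m f (p # ps) c) =
       m + query_count P (learn_thresholds q m f ps (c(p := s)))"
    using Cons.prems(2)[of i j] p by auto
  have "\<And>i j s. (i, j) \<in> set ps \<Longrightarrow> 0 \<le> s \<Longrightarrow> s \<le> 1 \<Longrightarrow> q j s \<in> P i j \<longleftrightarrow> s \<le> t i j"
    and "\<And>i j. (i, j) \<in> set ps \<Longrightarrow> 0 \<le> t i j \<and> t i j < 1" and "distinct ps"
    using Cons.prems by simp_all
  from Cons.IH[OF this, of "c(p := s)"]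
  obtain c' where c': "\<forall>p'. p' \<notin> set ps \<longrightarrow> c' p' = (c(p := s)) p'"
    "\<forall>(i, j)\<in>set ps. c' (i, j) \<le> t i j \<and> t i j < c' (i, j) + 1 / 2 ^ m"
    "result P (learn_thresholds q m f ps (c(p := s))) = f c'"
    "query_count P (learn_thresholds q m f ps (c(p := s))) = length ps * m"
    by blast
  \<comment> \<open>Since the list is distinct, later bisections do not overwrite this
    entry.\<close>
  have "c' (i, j) = s" using c'(1) Cons.prems(3) p by simp
  then show ?case using c' s p by (intro exI[of _ c']) auto
qed auto

lemma admissible_learn_thresholds:
  assumes "set ps \<subseteq> {1..d} \<times> {1..d}"
    and "\<And>j s. j \<in> {1..d} \<Longrightarrow> 0 \<le> s \<Longrightarrow> s \<le> 1 \<Longrightarrow> q j s \<in> vertex_simplex d v"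
    and "\<And>c. f c \<in> vertex_simplex d v"
  shows "admissible d v (learn_thresholds q m f ps c)"
  using assms(1)
proof (induction ps arbitrary: c)
  case (Cons p ps)
  then show ?case using assms(2) by (auto intro!: admissible_bisect)
qed (use assms(3) in simp)

text \<open>The edge from another vertex to \<open>v j\<close>: along it coordinate \<open>j\<close>
  runs through all of \<open>[0, 1]\<close>, so a query there compares \<open>s\<close> with the
  threshold.\<close>

definition edge_coords :: "nat \<Rightarrow> real \<Rightarrow> nat \<Rightarrow> real" where
  "edge_coords j s = (\<lambda>i. 0)(j := s, (if j = 1 then 2 else 1) := 1 - s)"

lemma edge_coords_in_bary_coords:
  assumes "2 \<le> d" "j \<in> {1..d}" "0 \<le> s" "s \<le> 1"
  shows "edge_coords j s \<in> bary_coords d"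
proof -
  define k where "k = (if j = 1 then 2 else 1 :: nat)"
  have k: "k \<in> {1..d}" "k \<noteq> j" using assms by (auto simp: k_def)
  have e: "edge_coords j s = (\<lambda>i. (if i = j then s else 0) + (if i = k then 1 - s else 0))"
    using k by (auto simp: edge_coords_def k_def fun_eq_iff)
  show ?thesis
    unfolding e bary_coords_def using assms k by (auto simp: sum.distrib)
qed

lemma edge_coords_same [simp]: "edge_coords j s j = s"
  by (simp add: edge_coords_def)

section \<open>Choosing the division point\<close>

text \<open>The truncations at 0 ensure the row-sum condition for every \<open>c\<close>, so that also the branches of the
  decision tree that no admissible preference sets reach output a point of the simplex.\<close>

definition lower_bounds :: "nat \<Rightarrow> (nat \<times> nat \<Rightarrow> real) \<Rightarrow> nat \<Rightarrow> nat \<Rightarrow> real" where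
  "lower_bounds d c i j =
     (if j = d then max 0 (1 - (\<Sum>k\<in>{1..<d}. max 0 (c (i, k)))) else max 0 (c (i, j)))"

text \<open>Only queries are counted, so a leaf may pick its point by choice; the choice depends on
  nothing but \<open>d\<close> and the learned values \<open>c\<close>.\<close>

definition robust_coords :: "nat \<Rightarrow> (nat \<times> nat \<Rightarrow> real) \<Rightarrow> nat \<Rightarrow> real" where
  "robust_coords d c = (SOME \<alpha>. \<alpha> \<in> bary_coords d \<and>
     (\<forall>S\<subseteq>{1..<d}. S \<noteq> {} \<longrightarrow> card S < card {k \<in> {1..d}. \<exists>i\<in>S. \<alpha> k \<le> lower_bounds d c i k}))"

lemma robust_coords:
  assumes "1 \<le> d"
  shows "robust_coords d c \<in> bary_coords d"
    and "S \<subseteq> {1..<d} \<Longrightarrow> S \<noteq> {} \<Longrightarrow>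
      card S < card {k \<in> {1..d}. \<exists>i\<in>S. robust_coords d c k \<le> lower_bounds d c i k}"
proof -
  have ins: "{1..d} = insert d {1..<d}" using assms by auto
  \<comment> \<open>The entry in column \<open>d\<close> fills the row up to at least 1.\<close>
  have "1 \<le> (\<Sum>k=1..d. lower_bounds d c i k)" for i
  proof -
    have "(\<Sum>k\<in>{1..<d}. lower_bounds d c i k) = (\<Sum>k\<in>{1..<d}. max 0 (c (i, k)))"
      by (intro sum.cong) (auto simp: lower_bounds_def)
    then show ?thesis unfolding ins by (simp add: lower_bounds_def)
  qed
  then have "\<exists>\<alpha>. \<alpha> \<in> bary_coords d \<and>
     (\<forall>S\<subseteq>{1..<d}. S \<noteq> {} \<longrightarrow> card S < card {k \<in> {1..d}. \<exists>i\<in>S. \<alpha> k \<le> lower_bounds d c i k})"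
    using exists_point_with_large_neighbourhoods[of "{1..<d}" "{1..d}" "lower_bounds d c"] assms
    by (auto simp: bary_coords_def lower_bounds_def)
  from someI_ex[OF this]
  show "robust_coords d c \<in> bary_coords d"
    and "S \<subseteq> {1..<d} \<Longrightarrow> S \<noteq> {} \<Longrightarrow>
      card S < card {k \<in> {1..d}. \<exists>i\<in>S. robust_coords d c k \<le> lower_bounds d c i k}"
    unfolding robust_coords_def by blast+
qed

text \<open>The same point serves every \<open>j\<close>: the surplus of accepted pieces lets Hall's
  condition survive the loss of piece \<open>j\<close>, whichever piece agent \<open>d\<close>
  takes.\<close>

lemma robust_coords_assignment:
  assumes "1 \<le> d" and j: "j \<in> {1..d}"
  shows "\<exists>\<sigma>. \<sigma> permutes {1..d} \<and> \<sigma> d = j \<and>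
    (\<forall>i\<in>{1..<d}. robust_coords d c (\<sigma> i) \<le> lower_bounds d c i (\<sigma> i))"
proof -
  define A where "A i = {k \<in> {1..d}. robust_coords d c k \<le> lower_bounds d c i k} - {j}" for i
  have "card S \<le> card (\<Union>i\<in>S. A i)" if S: "S \<subseteq> {1..<d}" for S
  proof (cases "S = {}")
    case False
    define B where "B = {k \<in> {1..d}. \<exists>i\<in>S. robust_coords d c k \<le> lower_bounds d c i k}"
    have "card S < card B"
      unfolding B_def using assms(1) S False by (rule robust_coords(2))
    also have "card B \<le> card (B - {j}) + 1"
      by (simp add: card_Diff_singleton_if) arith
    also have "B - {j} = (\<Union>i\<in>S. A i)"
      unfolding A_def B_def by blast
    finally show ?thesis by simp
  qed simp
  then obtain R where R: "inj_on R {1..<d}" "\<forall>i\<in>{1..<d}. R i \<in> A i"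
    using hall_marriage[of "{1..<d}" A] unfolding A_def by auto
  define \<sigma> where "\<sigma> i = (if i = d then j else if i \<in> {1..<d} then R i else i)" for i
  have RA: "R i \<in> {1..d} \<and> R i \<noteq> j" if "i \<in> {1..<d}" for i
    using R(2) that unfolding A_def by blast
  have "inj_on \<sigma> {1..d}"
  proof (rule inj_onI)
    fix x y assume "x \<in> {1..d}" "y \<in> {1..d}" "\<sigma> x = \<sigma> y"
    then show "x = y"
      using RA[of x] RA[of y] inj_onD[OF R(1), of x y] by (auto simp: \<sigma>_def split: if_splits)
  qed
  moreover have "\<sigma> ` {1..d} \<subseteq> {1..d}"
  proof (rule image_subsetI)
    fix x assume "x \<in> {1..d}"
    then show "\<sigma> x \<in> {1..d}" using RA[of x] j by (auto simp: \<sigma>_def)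
  qed
  ultimately have "bij_betw \<sigma> {1..d} {1..d}"
    by (simp add: bij_betw_def endo_inj_surj)
  then have "\<sigma> permutes {1..d}"
    by (rule bij_imp_permutes) (use \<open>1 \<le> d\<close> in \<open>auto simp: \<sigma>_def\<close>)
  moreover have "\<forall>i\<in>{1..<d}. robust_coords d c (\<sigma> i) \<le> lower_bounds d c i (\<sigma> i)"
    using R(2) by (auto simp: \<sigma>_def A_def)
  ultimately show ?thesis by (intro exI[of _ \<sigma>]) (simp add: \<sigma>_def)
qed

text \<open>For \<open>j < d\<close> the estimate, truncated at 0, stays below the threshold itself.
  For \<open>j = d\<close>, covering gives that \<open>t d\<close> is at least 1 minus the other
  thresholds, and the errors of those \<open>d - 1\<close> estimates add up to at most
  \<open>\<epsilon>\<close>.\<close>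

lemma lower_bounds_le:
  assumes "1 \<le> d" and j: "j \<in> {1..d}" and t0: "\<And>j. j \<in> {1..d} \<Longrightarrow> 0 \<le> t j"
    and t1: "1 \<le> (\<Sum>j=1..d. t j)"
    and c: "\<And>j. j \<in> {1..<d} \<Longrightarrow> c (i, j) \<le> t j \<and> t j \<le> c (i, j) + \<delta>"
    and \<delta>: "(real d - 1) * \<delta> \<le> \<epsilon>" and "0 \<le> \<epsilon>"
  shows "lower_bounds d c i j \<le> t j + \<epsilon>"
proof (cases "j = d")
  case True
  have ins: "{1..d} = insert d {1..<d}" using assms by auto
  have "1 \<le> t d + (\<Sum>k\<in>{1..<d}. t k)" using t1 unfolding ins by simp
  also have "(\<Sum>k\<in>{1..<d}. t k) \<le> (\<Sum>k\<in>{1..<d}. max 0 (c (i, k)) + \<delta>)"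
    using c by (intro sum_mono) (smt (verit))
  also have "\<dots> = (\<Sum>k\<in>{1..<d}. max 0 (c (i, k))) + (real d - 1) * \<delta>"
    using assms(1) by (simp add: sum.distrib of_nat_diff)
  finally show ?thesis using True \<delta> t0[OF j] \<open>0 \<le> \<epsilon>\<close> by (simp add: lower_bounds_def)
next
  case False
  then show ?thesis using c[of j] t0[OF j] j \<open>0 \<le> \<epsilon>\<close> by (auto simp: lower_bounds_def)
qed

theorem theorem4p3:
  fixes d :: nat and v :: "nat \<Rightarrow> 'a::euclidean_space" and \<epsilon> :: real and n :: int
  assumes "d \<ge> 2"
    and "DIM('a) = d - 1"
    and "regular_unit_simplex_vertices d v"
    and "\<epsilon> > 0"
    and "n = \<lceil>1 / \<epsilon>\<rceil>"
  shows "\<exists>T. admissible d v T \<and>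
    (\<forall>P. preference_sets d v P \<and> parallel_halfspace_sets d v P \<longrightarrow>
       int (query_count P T) \<le> (int d - 1)^2 * \<lceil>log 2 (of_int n * (real d - 1))\<rceil> \<and>
       fair_division_point d v \<epsilon> P (result P T))"
proof -
  note d = \<open>d \<ge> 2\<close> and reg = \<open>regular_unit_simplex_vertices d v\<close>
  have n: "1 / \<epsilon> \<le> of_int n" "0 < n" using assms(4,5) by auto
  define X where "X = of_int n * (real d - 1)"
  have "1 * 1 \<le> of_int n * (real d - 1)" using n d by (intro mult_mono) auto
  then have X1: "1 \<le> X" unfolding X_def by simp
  \<comment> \<open>The number of bisection steps per threshold; \<open>X \<ge> 1\<close> makes the
    logarithm nonnegative, so \<open>nat\<close> loses nothing.\<close>
  define m where "m = nat \<lceil>log 2 X\<rceil>"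
  have m: "int m = \<lceil>log 2 X\<rceil>"
  proof -
    have "0 \<le> log 2 X" using X1 by simp
    then have "0 \<le> \<lceil>log 2 X\<rceil>" by linarith
    then show ?thesis unfolding m_def by simp
  qed
  have "log 2 X \<le> real m" using m by linarith
  then have "X \<le> 2 ^ m" using X1 by (simp add: log_le_iff powr_realpow)
  \<comment> \<open>From \<open>n * (d - 1) \<le> 2 ^ m\<close> and
    \<open>1 / \<epsilon> \<le> n\<close>, the accumulated error of \<open>d - 1\<close> bisections
    is at most \<open>\<epsilon>\<close>.\<close>
  then have "of_int n * ((real d - 1) * (1 / 2 ^ m)) \<le> 1"
    by (simp add: X_def field_simps)
  moreover have "0 \<le> (real d - 1) * (1 / 2 ^ m)" using d by simp
  ultimately have "1 / \<epsilon> * ((real d - 1) * (1 / 2 ^ m)) \<le> 1"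
    using n(1) by (meson mult_right_mono order_trans)
  then have \<delta>: "(real d - 1) * (1 / 2 ^ m) \<le> \<epsilon>"
    using \<open>\<epsilon> > 0\<close> by (simp add: field_simps)
  \<comment> \<open>Neither agent \<open>d\<close> nor piece \<open>d\<close> is queried, which
    leaves \<open>(d - 1)^2\<close> bisections.\<close>
  define ps where "ps = List.product [1..<d] [1..<d]"
  define f where "f c = bary_point d v (robust_coords d c)" for c
  define T where "T = learn_thresholds (\<lambda>j s. bary_point d v (edge_coords j s)) m f ps (\<lambda>_. 0)"
  have "admissible d v T"
    unfolding T_def ps_def f_def
    using robust_coords(1) d
    by (intro admissible_learn_thresholds) (auto intro!: bary_point_in_simplex edge_coords_in_bary_coords)
  moreover have "int (query_count P T) \<le> (int d - 1)^2 * \<lceil>log 2 X\<rceil>"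
      and "fair_division_point d v \<epsilon> P (result P T)"
    if pref: "preference_sets d v P" and half: "parallel_halfspace_sets d v P" for P
  proof -
    have "\<exists>t. 0 \<le> t \<and> t < 1 \<and> P i j = threshold_set d v j t" if "i \<in> {1..d}" "j \<in> {1..d}" for i j
      using halfspace_set_eq_threshold_set[OF d that(2)] half that
      unfolding parallel_halfspace_sets_def by metis
    then obtain t where t: "\<And>i j. i \<in> {1..d} \<Longrightarrow> j \<in> {1..d} \<Longrightarrow>
        0 \<le> t i j \<and> t i j < 1 \<and> P i j = threshold_set d v j (t i j)" by metis
    have t1: "1 \<le> (\<Sum>j=1..d. t i j)" if i: "i \<in> {1..d}" for i
    proof (rule sum_thresholds_ge_1[OF reg])
      have "(\<Union>j\<in>{1..d}. P i j) = vertex_simplex d v"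
        using pref i unfolding preference_sets_def by blast
      then show "(\<Union>j\<in>{1..d}. threshold_set d v j (t i j)) = vertex_simplex d v"
        using t[OF i] by simp
    qed (use d t i in auto)
    have "distinct ps" unfolding ps_def by (simp add: distinct_product)
    moreover have ps: "set ps = {1..<d} \<times> {1..<d}" unfolding ps_def by simp
    moreover have "bary_point d v (edge_coords j s) \<in> P i j \<longleftrightarrow> s \<le> t i j"
      if "i \<in> {1..<d}" "j \<in> {1..<d}" "0 \<le> s" "s \<le> 1" for i j s
    proof -
      have "edge_coords j s \<in> bary_coords d" using edge_coords_in_bary_coords d that by simp
      then show ?thesis using t[of i j] that bary_point_in_threshold_set_iff[OF reg] by simp
    qed
    ultimately obtain c where c: "\<forall>(i, j)\<in>set ps. c (i, j) \<le> t i j \<and> t i j < c (i, j) + 1 / 2 ^ m"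
      and res: "result P T = f c" and count: "query_count P T = length ps * m"
      using learn_thresholds_correct[of ps "\<lambda>j s. bary_point d v (edge_coords j s)" P t "\<lambda>_. 0" m f] t
      unfolding T_def by fastforce
    have "int (length ps) = (int d - 1)^2"
      using d by (simp add: ps_def power2_eq_square of_nat_diff)
    then show "int (query_count P T) \<le> (int d - 1)^2 * \<lceil>log 2 X\<rceil>"
      using count m by simp
    let ?x = "bary_point d v (robust_coords d c)"
    have x: "robust_coords d c \<in> bary_coords d" using robust_coords(1) d by simp
    have "?x \<in> vertex_simplex d v" using x by (rule bary_point_in_simplex)
    \<comment> \<open>By covering, agent \<open>d\<close> accepts some piece at the output point.
      This \<open>j\<close> is not known to the algorithm; it occurs only in the analysis.\<close>
    moreover from this obtain j where j: "j \<in> {1..d}" "?x \<in> P d j"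
      using pref d unfolding preference_sets_def by (metis UN_E atLeastAtMost_iff le_refl one_le_numeral order_trans)
    obtain \<sigma> where \<sigma>: "\<sigma> permutes {1..d}" "\<sigma> d = j"
      "\<And>i. i \<in> {1..<d} \<Longrightarrow> robust_coords d c (\<sigma> i) \<le> lower_bounds d c i (\<sigma> i)"
      using robust_coords_assignment[OF _ j(1), of c] d by auto
    have "?x \<in> enlargement d v \<epsilon> (P i (\<sigma> i))" if i: "i \<in> {1..d}" for i
    proof -
      have \<sigma>i: "\<sigma> i \<in> {1..d}" using \<sigma>(1) i by (simp only: permutes_in_image)
      have "robust_coords d c (\<sigma> i) \<le> t i (\<sigma> i) + \<epsilon>"
      proof (cases "i = d")
        case True
        then have "robust_coords d c (\<sigma> i) \<le> t i (\<sigma> i)"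
          using j t[of d j] bary_point_in_threshold_set_iff[OF reg x] \<sigma>(2) i by simp
        then show ?thesis using \<open>\<epsilon> > 0\<close> by simp
      next
        case False
        then have i': "i \<in> {1..<d}" using i by simp
        have "lower_bounds d c i (\<sigma> i) \<le> t i (\<sigma> i) + \<epsilon>"
        proof (rule lower_bounds_le[OF _ \<sigma>i _ t1[OF i] _ \<delta>])
          fix k assume "k \<in> {1..<d}"
          then have "(i, k) \<in> set ps" using i' ps by simp
          then show "c (i, k) \<le> t i k \<and> t i k \<le> c (i, k) + 1 / 2 ^ m" using c by fastforce
        qed (use d t i \<open>\<epsilon> > 0\<close> in auto)
        then show ?thesis using \<sigma>(3)[OF i'] by linarith
      qed
      then show ?thesis
        using threshold_set_enlargement[OF reg d \<sigma>i x] t[OF i \<sigma>i] \<open>\<epsilon> > 0\<close> by auto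
    qed
    ultimately show "fair_division_point d v \<epsilon> P (result P T)"
      unfolding fair_division_point_def res f_def using \<sigma>(1) by blast
  qed
  ultimately show ?thesis unfolding X_def by blast
qed

end
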